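(* There exists a function $g\in\mathcal{B}$ such that for any $\varepsilon>0$ there exists $C(\varepsilon)>0$ with $$|g(z)-g(\zeta)|\le C(\varepsilon)+\varepsilon\,\beta(z,\zeta),\qquad z,\zeta\in\mathbb{D},$$ but $g$ does not belong to the closure of $H^p\cap\mathcal{B}$ in $\mathcal{B}$, for any $0<p\le\infty$.
   Context: $\mathbb{D}$ is the open unit disc, $\partial\mathbb{D}$ the unit circle, $m$ is Lebesgue measure on $\partial\mathbb{D}$. The Bloch space $\mathcal{B}$ is the space of analytic functions $g$ on $\mathbb{D}$ with $\|g\|_{\mathcal{B}}=\sup_{z\in\mathbb{D}}(1-|z|^2)|g'(z)|<\infty$; closures in $\mathcal{B}$ are taken with respect to this (semi-)norm. For $0<p<\infty$, $H^p$ is the Hardy space of analytic functions $f$ in $\mathbb{D}$ with $\sup_{0<r<1}\int_{\partial\mathbb{D}}|f(r\xi)|^p\,dm(\xi)<\infty$; $H^\infty$ is the algebra of bounded analytic functions in $\mathbb{D}$. The hyperbolic metric is $\beta(z,\zeta)=\frac12\log\frac{1+|\phi_z(\zeta)|}{1-|\phi_z(\zeta)|}$, where $\phi_z(\zeta)=\frac{z-\zeta}{1-\bar z\zeta}$, $z,\zeta\in\mathbb{D}$. *)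

theory Defs
  imports "HOL-Analysis.Analysis"
begin

text \<open>
  Functions on the unit disc are total functions on the complex plane, and only their values
  on the disc are ever used. Being analytic on the (open) disc is \<^term>\<open>(holomorphic_on)\<close>.
\<close>

abbreviation unit_disc :: "complex set" where
  "unit_disc \<equiv> ball 0 1"

definition disc_automorphism :: "complex \<Rightarrow> complex \<Rightarrow> complex" where
  "disc_automorphism z \<zeta> = (z - \<zeta>) / (1 - cnj z * \<zeta>)"

definition hyperbolic_dist :: "complex \<Rightarrow> complex \<Rightarrow> real" where
  "hyperbolic_dist z \<zeta> =
     1 / 2 * ln ((1 + cmod (disc_automorphism z \<zeta>)) / (1 - cmod (disc_automorphism z \<zeta>)))"

text \<open>
  The supremum is taken in \<^typ>\<open>ennreal\<close>, so it is a true supremum, also when it is infinite.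
  On the disc the argument of \<^const>\<open>ennreal\<close> is nonnegative, so nothing is truncated.
\<close>

definition bloch_seminorm :: "(complex \<Rightarrow> complex) \<Rightarrow> ennreal" where
  "bloch_seminorm g = (SUP z\<in>unit_disc. ennreal ((1 - (cmod z)\<^sup>2) * cmod (deriv g z)))"

definition bloch_space :: "(complex \<Rightarrow> complex) set" where
  "bloch_space = {g. g holomorphic_on unit_disc \<and> bloch_seminorm g < \<infinity>}"

definition bloch_closure :: "(complex \<Rightarrow> complex) set \<Rightarrow> (complex \<Rightarrow> complex) set" where
  "bloch_closure X =
     {g \<in> bloch_space. \<forall>e>0. \<exists>f\<in>X. bloch_seminorm (\<lambda>z. g z - f z) < ennreal e}"

text \<open>
  Arc length measure on the unit circle, as a Borel measure on the circle. It has total mass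
  \<open>2\<pi>\<close>; dividing by \<open>2\<pi>\<close> would not change the Hardy spaces below.
\<close>

definition circle_measure :: "complex measure" where
  "circle_measure =
     distr (restrict_space lborel {0..2 * pi}) (restrict_space borel (sphere 0 1)) cis"

lemma measurable_cis_circle:
  "cis \<in> measurable (restrict_space lborel {0..2 * pi}) (restrict_space borel (sphere 0 1))"
proof (rule measurable_restrict_space2)
  have "cis \<in> borel_measurable lborel"
    using borel_measurable_continuous_onI [of cis] continuous_on_cis [OF continuous_on_id]
    by (simp add: measurable_lborel1)
  then show "cis \<in> measurable (restrict_space lborel {0..2 * pi}) borel"
    by (rule measurable_restrict_space1)
qed auto

lemma emeasure_circle_measure: "emeasure circle_measure (sphere 0 1) = ennreal (2 * pi)"
proof -
  have "cis -` sphere 0 1 \<inter> space (restrict_space lborel {0..2 * pi}) = {0..2 * pi}"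
    by (auto simp: space_restrict_space)
  moreover have "sphere 0 1 \<in> sets (restrict_space borel (sphere (0::complex) 1))"
    by (simp add: sets_restrict_space_iff)
  ultimately show ?thesis
    unfolding circle_measure_def
    by (subst emeasure_distr [OF measurable_cis_circle])
       (simp_all add: emeasure_restrict_space)
qed

definition hardy_space :: "ereal \<Rightarrow> (complex \<Rightarrow> complex) set" where
  "hardy_space p =
     (if p = \<infinity> then {f. f holomorphic_on unit_disc \<and> bounded (f ` unit_disc)}
      else {f. f holomorphic_on unit_disc \<and>
               (SUP r\<in>{0<..<1::real}.
                  \<integral>\<^sup>+ \<xi>. ennreal (cmod (f (of_real r * \<xi>)) powr real_of_ereal p) \<partial>circle_measure) < \<infinity>})"

end

theory Submission
  imports Defs "HOL-Complex_Analysis.Complex_Analysis" "HOL-Real_Asymp.Real_Asymp"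
begin

text \<open>
  The witness is the gap series \<open>g z = (\<Sum>j. z ^ fact (Suc j))\<close>. For points at distance \<open>d\<close> of which the one
  closer to the circle is at distance \<open>h\<close> from it, the terms with exponents below \<open>1 / d\<close> or above \<open>1 / h\<close>
  contribute \<open>O(1)\<close> to \<open>g z - g w\<close>. As the ratios of consecutive exponents tend to infinity, at most
  \<open>C + \<epsilon> * ln (d / h)\<close> exponents lie in between, and \<open>ln (d / h) \<le> 2 * hyperbolic_dist z w + ln 4\<close>.

  If \<open>f\<close> is close to \<open>g\<close> in the Bloch seminorm, then \<open>F = f \<circ> exp\<close> satisfies \<open>cmod (F' w) \<ge> c * n\<close> on the
  strips \<open>- 2 / n \<le> Re w \<le> - 1 / n\<close>, for all large exponents \<open>n\<close> of the series. For \<open>f\<close> in a Hardy space the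
  integral means \<open>J\<close> of \<open>ln (1 + (cmod F)\<^sup>2)\<close> over the vertical segments \<open>{s} \<times> {0..2 * pi}\<close> are bounded.
  The Laplacian of this function is \<open>4 * (cmod F')\<^sup>2 / (1 + (cmod F)\<^sup>2)\<^sup>2\<close>, so \<open>J\<close> is convex, and by Jensen's
  inequality \<open>J'' \<ge> \<kappa> * n\<^sup>2\<close> on the strips. Hence each strip forces \<open>J\<close> to grow by a fixed
  amount, up to a linear function of \<open>s\<close>, contradicting boundedness.
\<close>

subsection \<open>Integral means of functions in Hardy spaces\<close>

text \<open>The chain rule along the horizontal and the vertical line through the point, with
  velocities \<open>1\<close> and \<open>\<i>\<close>; the signs in the last two claims are those of
  the Cauchy-Riemann equations.\<close>

lemma has_real_derivative_Re_Im_Complex: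
  assumes "(F has_field_derivative D) (at (Complex s t))"
  shows "((\<lambda>s. Re (F (Complex s t))) has_real_derivative Re D) (at s)"
    and "((\<lambda>s. Im (F (Complex s t))) has_real_derivative Im D) (at s)"
    and "((\<lambda>t. Re (F (Complex s t))) has_real_derivative - Im D) (at t)"
    and "((\<lambda>t. Im (F (Complex s t))) has_real_derivative Re D) (at t)"
proof -
  have "((\<lambda>s. Complex s t) has_vector_derivative 1) (at s)"
    unfolding Complex_eq by (auto intro!: derivative_eq_intros)
  from field_vector_diff_chain_at[OF this assms]
  have s: "((\<lambda>s. F (Complex s t)) has_vector_derivative D) (at s)"
    by (simp add: o_def)
  have "((\<lambda>t. Complex s t) has_vector_derivative \<i>) (at t)"
    unfolding Complex_eq by (auto intro!: derivative_eq_intros)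
  from field_vector_diff_chain_at[OF this assms]
  have t: "((\<lambda>t. F (Complex s t)) has_vector_derivative \<i> * D) (at t)"
    by (simp add: o_def)
  show "((\<lambda>s. Re (F (Complex s t))) has_real_derivative Re D) (at s)"
    "((\<lambda>s. Im (F (Complex s t))) has_real_derivative Im D) (at s)"
    "((\<lambda>t. Re (F (Complex s t))) has_real_derivative - Im D) (at t)"
    "((\<lambda>t. Im (F (Complex s t))) has_real_derivative Re D) (at t)"
    using bounded_linear.has_vector_derivative[OF bounded_linear_Re s]
      bounded_linear.has_vector_derivative[OF bounded_linear_Im s]
      bounded_linear.has_vector_derivative[OF bounded_linear_Re t]
      bounded_linear.has_vector_derivative[OF bounded_linear_Im t]
    by (simp_all add: has_real_derivative_iff_has_vector_derivative)
qed

text \<open>Differentiating twice under the integral gives the integral of the second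
  \<open>s\<close>-derivative of \<open>V = ln (1 + |F|^2)\<close>. By periodicity the second
  \<open>t\<close>-derivative has integral zero, so it can be added to complete the
  Laplacian.\<close>

lemma second_derivative_integral_ln_one_plus_norm_squared:
  fixes F F1 F2 :: "complex \<Rightarrow> complex"
  assumes F: "\<And>w. Re w < 0 \<Longrightarrow> (F has_field_derivative F1 w) (at w)"
    and F1: "\<And>w. Re w < 0 \<Longrightarrow> (F1 has_field_derivative F2 w) (at w)"
    and F2: "continuous_on {w. Re w < 0} F2"
    and per: "\<And>s. F (Complex s (2 * pi)) = F (Complex s 0)"
      "\<And>s. F1 (Complex s (2 * pi)) = F1 (Complex s 0)"
  shows "\<exists>J1. \<forall>s<0.
    ((\<lambda>s. integral {0..2*pi} (\<lambda>t. ln (1 + (cmod (F (Complex s t)))\<^sup>2))) has_real_derivative J1 s) (at s) \<and>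
    (J1 has_real_derivative integral {0..2*pi}
      (\<lambda>t. 4 * (cmod (F1 (Complex s t)))\<^sup>2 / (1 + (cmod (F (Complex s t)))\<^sup>2)\<^sup>2)) (at s)"
proof -
  define A B C E G H where
    "A = (\<lambda>s t. Re (F (Complex s t)))" and "B = (\<lambda>s t. Im (F (Complex s t)))" and
    "C = (\<lambda>s t. Re (F1 (Complex s t)))" and "E = (\<lambda>s t. Im (F1 (Complex s t)))" and
    "G = (\<lambda>s t. Re (F2 (Complex s t)))" and "H = (\<lambda>s t. Im (F2 (Complex s t)))"
  define D where "D = (\<lambda>s t. 1 + (A s t)\<^sup>2 + (B s t)\<^sup>2)"
  have Dpos: "D s t > 0" for s t
    unfolding D_def by (smt (verit) zero_le_power2)
  have Dnz: "1 + (A s t)\<^sup>2 + (B s t)\<^sup>2 \<noteq> 0" "1 + (A s t)\<^sup>2 + (B s t)\<^sup>2 > 0" "D s t \<noteq> 0" for s t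
    using Dpos[of s t] unfolding D_def by auto
  have norm2: "1 + (cmod (F (Complex s t)))\<^sup>2 = D s t" for s t
    unfolding D_def A_def B_def cmod_power2 by simp
  have norm1: "(cmod (F1 (Complex s t)))\<^sup>2 = (C s t)\<^sup>2 + (E s t)\<^sup>2" for s t
    unfolding C_def E_def cmod_power2 by simp
  have dF: "((\<lambda>s. A s t) has_real_derivative C s t) (at s)"
    "((\<lambda>s. B s t) has_real_derivative E s t) (at s)"
    "((\<lambda>t. A s t) has_real_derivative - E s t) (at t)"
    "((\<lambda>t. B s t) has_real_derivative C s t) (at t)" if "s < 0" for s t
    using has_real_derivative_Re_Im_Complex[OF F, of s t] that unfolding A_def B_def C_def E_def by simp_all
  have dF1: "((\<lambda>s. C s t) has_real_derivative G s t) (at s)"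
    "((\<lambda>s. E s t) has_real_derivative H s t) (at s)"
    "((\<lambda>t. C s t) has_real_derivative - H s t) (at t)"
    "((\<lambda>t. E s t) has_real_derivative G s t) (at t)" if "s < 0" for s t
    using has_real_derivative_Re_Im_Complex[OF F1, of s t] that unfolding C_def E_def G_def H_def by simp_all
  have cont: "continuous_on ({..<0} \<times> cbox 0 (2*pi)) (\<lambda>p. \<Phi> (Complex (fst p) (snd p)))"
    if "continuous_on {w. Re w < 0} \<Phi>" for \<Phi> :: "complex \<Rightarrow> complex"
    by (rule continuous_on_compose2[OF that])
       (auto simp: Complex_eq intro!: continuous_intros)
  have cF: "continuous_on {w. Re w < 0} F" "continuous_on {w. Re w < 0} F1"
    using F F1 by (auto intro!: DERIV_continuous_on intro: has_field_derivative_at_within)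
  have [continuous_intros]: "continuous_on ({..<0} \<times> cbox 0 (2*pi)) (\<lambda>p. A (fst p) (snd p))"
    "continuous_on ({..<0} \<times> cbox 0 (2*pi)) (\<lambda>p. B (fst p) (snd p))"
    "continuous_on ({..<0} \<times> cbox 0 (2*pi)) (\<lambda>p. C (fst p) (snd p))"
    "continuous_on ({..<0} \<times> cbox 0 (2*pi)) (\<lambda>p. E (fst p) (snd p))"
    "continuous_on ({..<0} \<times> cbox 0 (2*pi)) (\<lambda>p. G (fst p) (snd p))"
    "continuous_on ({..<0} \<times> cbox 0 (2*pi)) (\<lambda>p. H (fst p) (snd p))"
    unfolding A_def B_def C_def E_def G_def H_def
    by (intro continuous_on_Re continuous_on_Im cont cF F2)+
  have slice: "\<Phi> s integrable_on cbox 0 (2*pi)"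
    if "continuous_on ({..<0} \<times> cbox 0 (2*pi)) (\<lambda>p. \<Phi> (fst p) (snd p))" "s < 0" for \<Phi> :: "real \<Rightarrow> real \<Rightarrow> real" and s
  proof -
    have "continuous_on (cbox 0 (2*pi)) (\<lambda>t. \<Phi> (fst (s, t)) (snd (s, t)))"
      by (rule continuous_on_compose2[OF that(1)]) (use that(2) in \<open>auto intro!: continuous_intros\<close>)
    then show ?thesis by (simp add: integrable_continuous_interval)
  qed
  have cD: "continuous_on ({..<0} \<times> cbox 0 (2*pi)) (\<lambda>p. D (fst p) (snd p))"
    unfolding D_def by (intro continuous_intros)
  define V where "V = (\<lambda>s t. ln (D s t))"
  define V1 where "V1 = (\<lambda>s t. 2 * (A s t * C s t + B s t * E s t) / D s t)"
  define V2 where "V2 = (\<lambda>s t. 2 * ((C s t)\<^sup>2 + (E s t)\<^sup>2 + A s t * G s t + B s t * H s t) / D s t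
      - (2 * (A s t * C s t + B s t * E s t))\<^sup>2 / (D s t)\<^sup>2)"
  \<comment> \<open>\<open>P\<close> is minus the \<open>t\<close>-derivative of \<open>V\<close>,
    so \<open>V2 s t - P1 s t\<close> is the Laplacian of \<open>V\<close>.\<close>
  define P where "P = (\<lambda>s t. 2 * (A s t * E s t - B s t * C s t) / D s t)"
  define P1 where "P1 = (\<lambda>s t. 2 * (- (C s t)\<^sup>2 - (E s t)\<^sup>2 + A s t * G s t + B s t * H s t) / D s t
      + (2 * (A s t * E s t - B s t * C s t))\<^sup>2 / (D s t)\<^sup>2)"
  have cV: "continuous_on ({..<0} \<times> cbox 0 (2*pi)) (\<lambda>p. V (fst p) (snd p))"
    "continuous_on ({..<0} \<times> cbox 0 (2*pi)) (\<lambda>p. V1 (fst p) (snd p))"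
    "continuous_on ({..<0} \<times> cbox 0 (2*pi)) (\<lambda>p. V2 (fst p) (snd p))"
    unfolding V_def V1_def V2_def by (intro continuous_intros cD; simp add: Dnz)+
  have dV: "((\<lambda>s. V s t) has_real_derivative V1 s t) (at s)" if "s < 0" for s t
    unfolding V_def V1_def D_def using that Dnz
    by (auto intro!: derivative_eq_intros dF simp: field_simps)
  have dV1: "((\<lambda>s. V1 s t) has_real_derivative V2 s t) (at s)" if "s < 0" for s t
    unfolding V2_def V1_def D_def using that Dnz
    by (auto intro!: derivative_eq_intros dF dF1 simp: divide_simps) (simp add: algebra_simps power2_eq_square)
  have dP: "((\<lambda>t. P s t) has_real_derivative P1 s t) (at t)" if "s < 0" for s t
    unfolding P_def P1_def D_def using that Dnz
    by (auto intro!: derivative_eq_intros dF dF1 simp: divide_simps) (simp add: algebra_simps power2_eq_square)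
  have iP: "(P1 s has_integral 0) {0..2*pi}" if "s < 0" for s
  proof -
    have "(P1 s has_integral (P s (2*pi) - P s 0)) {0..2*pi}"
      by (rule fundamental_theorem_of_calculus)
        (use dP[OF that] in \<open>auto simp: has_real_derivative_iff_has_vector_derivative[symmetric]
            intro: has_field_derivative_at_within\<close>)
    moreover have "P s (2*pi) = P s 0"
      unfolding P_def D_def A_def B_def C_def E_def per ..
    ultimately show ?thesis by simp
  qed
  have eq: "V2 s t - P1 s t = 4 * (cmod (F1 (Complex s t)))\<^sup>2 / (1 + (cmod (F (Complex s t)))\<^sup>2)\<^sup>2" for s t
  proof -
    have "V2 s t - P1 s t = (4 * ((C s t)\<^sup>2 + (E s t)\<^sup>2) * D s t
      - (2 * (A s t * C s t + B s t * E s t))\<^sup>2 - (2 * (A s t * E s t - B s t * C s t))\<^sup>2) / (D s t)\<^sup>2"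
      unfolding V2_def P1_def using Dnz[of s t] by (simp add: divide_simps) (simp add: algebra_simps power2_eq_square)
    \<comment> \<open>Lagrange's identity
      \<open>(A C + B E)^2 + (A E - B C)^2 = (A^2 + B^2) (C^2 + E^2)\<close> cancels all of
      \<open>D s t\<close> but its summand \<open>1\<close>.\<close>
    also have "4 * ((C s t)\<^sup>2 + (E s t)\<^sup>2) * D s t - (2 * (A s t * C s t + B s t * E s t))\<^sup>2
        - (2 * (A s t * E s t - B s t * C s t))\<^sup>2 = 4 * ((C s t)\<^sup>2 + (E s t)\<^sup>2)"
      unfolding D_def by (simp add: algebra_simps power2_eq_square)
    finally show ?thesis by (simp add: norm1 norm2)
  qed
  have "((\<lambda>s. integral (cbox 0 (2*pi)) (V s)) has_real_derivative integral (cbox 0 (2*pi)) (V1 s)) (at s)"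
    if "s < 0" for s
    using leibniz_rule_field_derivative[of "{..<0}" 0 "2*pi" V V1 s]
      dV slice[OF cV(1)] cV(2) that
    by (simp add: has_field_derivative_at_within case_prod_unfold at_within_open[of s "{..<0}"])
  moreover have "((\<lambda>s. integral (cbox 0 (2*pi)) (V1 s)) has_real_derivative integral (cbox 0 (2*pi)) (V2 s)) (at s)"
    if "s < 0" for s
    using leibniz_rule_field_derivative[of "{..<0}" 0 "2*pi" V1 V2 s]
      dV1 slice[OF cV(2)] cV(3) that
    by (simp add: has_field_derivative_at_within case_prod_unfold at_within_open[of s "{..<0}"])
  moreover have "integral {0..2*pi} (V2 s) = integral {0..2*pi} (\<lambda>t. V2 s t - P1 s t)" if "s < 0" for s
  proof (subst integral_diff)
    show "V2 s integrable_on {0..2*pi}" using slice[OF cV(3) that] by simp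
  qed (use iP[OF that] in \<open>auto simp: has_integral_iff\<close>)
  moreover have lnV: "(\<lambda>t. ln (1 + (cmod (F (Complex s t)))\<^sup>2)) = V s" for s
    by (simp add: V_def norm2)
  ultimately show ?thesis
    unfolding lnV eq[symmetric]
    by (intro exI[of _ "\<lambda>s. integral {0..2*pi} (V1 s)"]) auto
qed

text \<open>After adding a linear function, \<open>J\<close> is nondecreasing and bounded above on
  \<open>{-1..<0}\<close>, so near \<open>0\<close> it is within \<open>\<kappa> / 8\<close> of its
  supremum. But on a strip the slope rises by \<open>\<kappa> / x j\<close>, and over the next
  interval of length \<open>x j / 2\<close> the function then rises by
  \<open>\<kappa> / 2\<close>.\<close>

lemma convex_bounded_above_contradiction:
  fixes J J1 K :: "real \<Rightarrow> real" and x :: "nat \<Rightarrow> real"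
  assumes J: "\<And>s. s < 0 \<Longrightarrow> (J has_real_derivative J1 s) (at s)"
    and J1: "\<And>s. s < 0 \<Longrightarrow> (J1 has_real_derivative K s) (at s)"
    and K: "\<And>s. s < 0 \<Longrightarrow> K s \<ge> 0"
    and M: "\<And>s. s < 0 \<Longrightarrow> J s \<le> M"
    and x: "\<And>j. x j > 0" "x \<longlonglongrightarrow> 0"
    and \<kappa>: "\<kappa> > 0" "\<forall>\<^sub>F j in sequentially. \<forall>s\<in>{-2 * x j..-x j}. K s \<ge> \<kappa> / (x j)\<^sup>2"
  shows False
proof -
  have J1_mono: "J1 a \<le> J1 b" if "a \<le> b" "b < 0" for a b
    using DERIV_nonneg_imp_nondecreasing[of a b J1] J1 K that by (meson order_le_less_trans)
  \<comment> \<open>This makes the derivative of \<open>\<Phi>\<close> vanish at \<open>-1\<close>,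
    hence nonnegative to the right of \<open>-1\<close>, since \<open>J1\<close> is
    nondecreasing.\<close>
  define A where "A = - J1 (-1)"
  define \<Phi> where "\<Phi> = (\<lambda>s. J s + A * s)"
  have d\<Phi>: "(\<Phi> has_real_derivative J1 s + A) (at s)" if "s < 0" for s
    unfolding \<Phi>_def using J[OF that] by (auto intro!: derivative_eq_intros)
  have \<Phi>_mono: "\<Phi> a \<le> \<Phi> b" if "-1 \<le> a" "a \<le> b" "b < 0" for a b
  proof (rule DERIV_nonneg_imp_nondecreasing[OF that(2)])
    fix s assume "a \<le> s" "s \<le> b"
    then show "\<exists>y. (\<Phi> has_real_derivative y) (at s) \<and> 0 \<le> y"
      using d\<Phi>[of s] J1_mono[of "-1" s] that by (force simp: A_def)
  qed
  have \<Phi>_bd: "\<Phi> s \<le> M + \<bar>A\<bar>" if "s \<in> {-1..<0}" for s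
  proof -
    have "A * s \<le> \<bar>A\<bar> * \<bar>s\<bar>" by (metis abs_ge_self abs_mult)
    also have "\<dots> \<le> \<bar>A\<bar>" by (rule mult_left_le) (use that in auto)
    finally show ?thesis using M[of s] that by (auto simp: \<Phi>_def)
  qed
  define S where "S = Sup (\<Phi> ` {-1..<0})"
  have bdd: "bdd_above (\<Phi> ` {-1..<0})" using \<Phi>_bd by (meson bdd_aboveI2)
  have "\<exists>y\<in>\<Phi> ` {-1..<0}. S - \<kappa> / 8 < y"
    unfolding S_def by (rule less_cSupD) (use \<kappa> in auto)
  then obtain s1 where s1: "s1 \<in> {-1..<0}" "S - \<kappa> / 8 < \<Phi> s1" by auto
  \<comment> \<open>\<open>x j < \<eta>\<close> puts \<open>- x j\<close> to the right of
    \<open>s1\<close>, where \<open>\<Phi>\<close> is already nearly \<open>S\<close>, and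
    \<open>-2 * x j\<close> to the right of \<open>-1\<close>.\<close>
  define \<eta> where "\<eta> = min (- s1) (min (1/2) (\<kappa> / (4 * (\<bar>A\<bar> + 1))))"
  have "\<eta> > 0" unfolding \<eta>_def using s1 \<kappa> by auto
  have "\<forall>\<^sub>F j in sequentially. x j < \<eta>"
    using order_tendstoD(2)[OF x(2) \<open>\<eta> > 0\<close>] .
  then obtain j where j: "x j < \<eta>" "\<forall>s\<in>{-2 * x j..-x j}. K s \<ge> \<kappa> / (x j)\<^sup>2"
    using eventually_happens[OF eventually_conj[OF _ \<kappa>(2)]] by (metis (no_types, lifting) sequentially_bot)
  let ?x = "x j"
  have xp: "?x > 0" by (rule x)
  have xs: "?x < - s1" "?x < 1/2" "?x * (\<bar>A\<bar> + 1) < \<kappa> / 4"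
    using j(1) unfolding \<eta>_def by (auto simp: field_simps)
  obtain s where s: "-2 * ?x < s" "s < - ?x" "J1 (- ?x) - J1 (-2 * ?x) = (- ?x - (-2 * ?x)) * K s"
    using MVT2[of "-2 * ?x" "- ?x" J1 K] J1 xp by auto
  have "\<kappa> / ?x = ?x * (\<kappa> / ?x\<^sup>2)" by (simp add: power2_eq_square)
  also have "\<dots> \<le> ?x * K s" using j(2) s xp by (intro mult_left_mono) auto
  finally have "J1 (- ?x) \<ge> \<kappa> / ?x + J1 (-2 * ?x)" using s(3) by simp
  moreover have "J1 (-2 * ?x) \<ge> - A" using J1_mono[of "-1" "-2 * ?x"] xs xp by (simp add: A_def)
  ultimately have big: "J1 (- ?x) + A \<ge> \<kappa> / ?x" by simp
  \<comment> \<open>On the interval right after the strip the slope gained is kept, and stopping at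
    \<open>- x j / 2\<close> stays in the domain \<open>s < 0\<close>.\<close>
  obtain u where u: "- ?x < u" "u < - ?x / 2" "\<Phi> (- ?x / 2) - \<Phi> (- ?x) = (- ?x / 2 - (- ?x)) * (J1 u + A)"
    using MVT2[of "- ?x" "- ?x / 2" \<Phi> "\<lambda>s. J1 s + A"] d\<Phi> xp by auto
  have "\<kappa> / 2 = ?x / 2 * (\<kappa> / ?x)" using xp by simp
  also have "\<dots> \<le> ?x / 2 * (J1 u + A)"
    using big J1_mono[of "- ?x" u] u xp by (intro mult_left_mono) auto
  finally have "\<Phi> (- ?x / 2) \<ge> \<Phi> (- ?x) + \<kappa> / 2" using u(3) by simp
  moreover have "\<Phi> (- ?x) \<ge> \<Phi> s1" using \<Phi>_mono[of s1 "- ?x"] s1 xs xp by auto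
  moreover have "\<Phi> (- ?x / 2) \<le> S" unfolding S_def
    by (rule cSup_upper[OF imageI bdd]) (use xs xp in auto)
  ultimately show False using s1 \<kappa> by linarith
qed

section \<open>From Hardy spaces to logarithmic means\<close>

text \<open>Serves to control logarithmic means by \<open>p\<close>-th power means for every
  \<open>p > 0\<close>. For \<open>x \<le> 1\<close> the constant suffices; for \<open>x > 1\<close>
  use \<open>1 + x^2 \<le> 2 * x^2\<close> and
  \<open>p * ln x = ln (x powr p) \<le> x powr p\<close>.\<close>

lemma ln_one_plus_square_le_powr:
  fixes x p :: real
  assumes "x \<ge> 0" "p > 0"
  shows "ln (1 + x\<^sup>2) \<le> ln 2 + 2 / p * x powr p"
proof (cases "x \<le> 1")
  case True
  then have "1 + x\<^sup>2 \<le> 2" using assms by (simp add: power_le_one)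
  then have "ln (1 + x\<^sup>2) \<le> ln 2" by (smt (verit) ln_mono zero_le_power2)
  moreover have "0 \<le> 2 / p * x powr p" using assms by simp
  ultimately show ?thesis by linarith
next
  case False
  then have "ln (1 + x\<^sup>2) \<le> ln (2 * x\<^sup>2)"
    by (intro ln_mono) (auto simp: add_nonneg_pos abs_square_le_1 add_pos_nonneg)
  also have "\<dots> = ln 2 + 2 * ln x" using False by (simp add: ln_mult ln_realpow)
  also have "p * ln x \<le> x powr p"
    using ln_le_minus_one[of "x powr p"] False by (simp add: ln_powr)
  then have "2 * ln x \<le> 2 / p * x powr p" using assms by (simp add: field_simps)
  finally show ?thesis by simp
qed

lemma exp_Complex_left: "exp (Complex s t) = of_real (exp s) * cis t"
  by (simp add: exp_eq_polar)

text \<open>The segment \<open>{s} \<times> {0..2 * pi}\<close> is mapped by \<open>exp\<close> onto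
  the circle of radius \<open>exp s < 1\<close>, so for finite \<open>p\<close> the power means over
  it are those in the definition of the Hardy space. If \<open>p = \<infinity>\<close>, the
  integrand itself is bounded.\<close>

lemma hardy_space_ln_bounded:
  assumes f: "f \<in> hardy_space p" and p: "0 < p"
  shows "\<exists>M. \<forall>s<0. integral {0..2*pi} (\<lambda>t. ln (1 + (cmod (f (exp (Complex s t))))\<^sup>2)) \<le> M"
proof -
  have hol: "f holomorphic_on unit_disc" using f by (auto simp: hardy_space_def split: if_splits)
  have cf: "continuous_on {0..2*pi} (\<lambda>t. f (exp (Complex s t)))" if "s < 0" for s
    by (rule continuous_on_compose2[OF holomorphic_on_imp_continuous_on[OF hol]])
      (use that in \<open>auto simp: Complex_eq norm_exp intro!: continuous_intros\<close>)
  have cln: "continuous_on {0..2*pi} (\<lambda>t. ln (1 + (cmod (f (exp (Complex s t))))\<^sup>2))" if "s < 0" for s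
    by (intro continuous_intros cf that) (smt (verit) zero_le_power2)
  show ?thesis
  proof (cases "p = \<infinity>")
    case True
    then have "bounded (f ` unit_disc)" using f by (simp add: hardy_space_def)
    then obtain B where B: "\<And>z. z \<in> unit_disc \<Longrightarrow> cmod (f z) \<le> B"
      unfolding bounded_iff by blast
    have "integral {0..2*pi} (\<lambda>t. ln (1 + (cmod (f (exp (Complex s t))))\<^sup>2)) \<le> integral {0..2*pi} (\<lambda>t. ln (1 + B\<^sup>2))"
      if "s < 0" for s
    proof (rule integral_le)
      fix t
      have "cmod (f (exp (Complex s t))) \<le> B" by (rule B) (use that in \<open>simp add: norm_exp\<close>)
      then show "ln (1 + (cmod (f (exp (Complex s t))))\<^sup>2) \<le> ln (1 + B\<^sup>2)"
        by (intro ln_mono add_left_mono power_mono) (auto simp: add_pos_nonneg)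
    qed (use integrable_continuous_interval[OF cln[OF that]] in auto)
    then show ?thesis by blast
  next
    case False
    define q where "q = real_of_ereal p"
    have q: "q > 0" using False p by (cases p) (auto simp: q_def)
    define S where "S = (SUP r\<in>{0<..<1::real}.
        \<integral>\<^sup>+ \<xi>. ennreal (cmod (f (of_real r * \<xi>)) powr q) \<partial>circle_measure)"
    have S: "S < \<infinity>" using f False by (auto simp: hardy_space_def S_def q_def)
    have le: "integral {0..2*pi} (\<lambda>t. cmod (f (exp (Complex s t))) powr q) \<le> enn2real S" if s: "s < 0" for s
    proof -
      let ?r = "exp s"
      have cp: "continuous_on {0..2*pi} (\<lambda>t. cmod (f (exp (Complex s t))) powr q)"
        by (intro continuous_on_powr' continuous_intros cf s) (use q in auto)
      have ci: "continuous_on (sphere 0 1) (\<lambda>\<xi>. cmod (f (of_real ?r * \<xi>)) powr q)"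
        by (intro continuous_on_powr' continuous_intros continuous_on_compose2[OF holomorphic_on_imp_continuous_on[OF hol]])
          (use q s in \<open>auto simp: norm_mult\<close>)
      have meas: "(\<lambda>\<xi>. ennreal (cmod (f (of_real ?r * \<xi>)) powr q)) \<in> borel_measurable circle_measure"
        unfolding circle_measure_def measurable_distr_eq1
        using borel_measurable_continuous_on_restrict[OF ci] by measurable
      have "(\<integral>\<^sup>+ \<xi>. ennreal (cmod (f (of_real ?r * \<xi>)) powr q) \<partial>circle_measure)
          = (\<integral>\<^sup>+ t. ennreal (cmod (f (of_real ?r * cis t)) powr q) \<partial>restrict_space lborel {0..2*pi})"
        unfolding circle_measure_def
        by (rule nn_integral_distr[OF measurable_cis_circle meas[unfolded circle_measure_def]])
      also have "\<dots> = (\<integral>\<^sup>+t\<in>{0..2*pi}. ennreal (cmod (f (exp (Complex s t))) powr q)\<partial>lborel)"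
        by (subst nn_integral_restrict_space) (auto simp: exp_Complex_left)
      also have "\<dots> = ennreal (integral {0..2*pi} (\<lambda>t. cmod (f (exp (Complex s t))) powr q))"
        by (rule nn_integral_has_integral_lebesgue')
           (use integrable_integral[OF integrable_continuous_interval[OF cp]] in auto)
      finally have eq: "(\<integral>\<^sup>+ \<xi>. ennreal (cmod (f (of_real ?r * \<xi>)) powr q) \<partial>circle_measure)
          = ennreal (integral {0..2*pi} (\<lambda>t. cmod (f (exp (Complex s t))) powr q))" .
      have "ennreal (integral {0..2*pi} (\<lambda>t. cmod (f (exp (Complex s t))) powr q)) \<le> S"
        unfolding S_def eq[symmetric] by (rule SUP_upper) (use s in simp)
      then have "enn2real (ennreal (integral {0..2*pi} (\<lambda>t. cmod (f (exp (Complex s t))) powr q))) \<le> enn2real S"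
        by (rule enn2real_mono) (use S in simp)
      moreover have "0 \<le> integral {0..2*pi} (\<lambda>t. cmod (f (exp (Complex s t))) powr q)"
        by (rule integral_nonneg[OF integrable_continuous_interval[OF cp]]) simp
      ultimately show ?thesis by simp
    qed
    have "integral {0..2*pi} (\<lambda>t. ln (1 + (cmod (f (exp (Complex s t))))\<^sup>2)) \<le> 2*pi * ln 2 + 2 / q * enn2real S"
      if s: "s < 0" for s
    proof -
      have cp: "continuous_on {0..2*pi} (\<lambda>t. cmod (f (exp (Complex s t))) powr q)"
        by (intro continuous_on_powr' continuous_intros cf s) (use q in auto)
      have "integral {0..2*pi} (\<lambda>t. ln (1 + (cmod (f (exp (Complex s t))))\<^sup>2))
        \<le> integral {0..2*pi} (\<lambda>t. ln 2 + 2 / q * cmod (f (exp (Complex s t))) powr q)"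
      proof (rule integral_le)
        show "(\<lambda>t. ln 2 + 2 / q * cmod (f (exp (Complex s t))) powr q) integrable_on {0..2*pi}"
          by (intro integrable_continuous_interval continuous_on_add continuous_on_mult continuous_on_const cp)
        show "ln (1 + (cmod (f (exp (Complex s t))))\<^sup>2) \<le> ln 2 + 2 / q * cmod (f (exp (Complex s t))) powr q" for t
          by (rule ln_one_plus_square_le_powr) (use q in auto)
      qed (rule integrable_continuous_interval[OF cln[OF s]])
      also have "\<dots> = 2*pi * ln 2 + 2 / q * integral {0..2*pi} (\<lambda>t. cmod (f (exp (Complex s t))) powr q)"
        by (subst integral_add)
           (intro integrable_continuous_interval continuous_on_mult continuous_on_const cp | simp)+
      also have "\<dots> \<le> 2*pi * ln 2 + 2 / q * enn2real S"
        using le[OF s] q by (intro add_left_mono mult_left_mono) auto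
      finally show ?thesis .
    qed
    then show ?thesis by blast
  qed
qed

text \<open>Jensen's inequality for the convex function \<open>exp (- 2 v)\<close>, by way of its tangent at \<open>M / (2 * pi)\<close>.\<close>

lemma integral_inverse_square_lower_bound:
  fixes h :: "real \<Rightarrow> real"
  assumes cont: "continuous_on {0..2*pi} h" and h: "\<And>t. h t > 0"
    and M: "integral {0..2*pi} (\<lambda>t. ln (h t)) \<le> M"
  shows "2 * pi * exp (- M / pi) \<le> integral {0..2*pi} (\<lambda>t. 1 / (h t)\<^sup>2)"
proof -
  have hnz: "h t \<noteq> 0" for t using h[of t] by simp
  have cl: "continuous_on {0..2*pi} (\<lambda>t. ln (h t))"
    by (intro continuous_intros cont) (simp add: hnz)
  have pt: "exp (- M / pi) * (1 + M / pi) + (- 2 * exp (- M / pi)) * ln (h t) \<le> 1 / (h t)\<^sup>2" for t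
  proof -
    have "exp (- M / pi) * (1 + (M / pi - 2 * ln (h t))) \<le> exp (- M / pi) * exp (M / pi - 2 * ln (h t))"
      by (intro mult_left_mono exp_ge_add_one_self) auto
    also have "\<dots> = exp (- (2 * ln (h t)))" by (simp add: exp_add[symmetric])
    also have "\<dots> = 1 / (h t)\<^sup>2"
      using h[of t] by (simp add: exp_minus exp_double field_simps)
    finally show ?thesis by (simp add: algebra_simps)
  qed
  have "2 * pi * exp (- M / pi) = 2 * pi * (exp (- M / pi) * (1 + M / pi)) + (- 2 * exp (- M / pi)) * M"
    by (simp add: field_simps)
  also have "\<dots> \<le> 2 * pi * (exp (- M / pi) * (1 + M / pi)) + (- 2 * exp (- M / pi)) * integral {0..2*pi} (\<lambda>t. ln (h t))"
    using M by (intro add_left_mono mult_left_mono_neg) auto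
  also have "\<dots> = integral {0..2*pi} (\<lambda>t. exp (- M / pi) * (1 + M / pi) + (- 2 * exp (- M / pi)) * ln (h t))"
    by (subst integral_add)
       (intro integrable_continuous_interval continuous_on_mult continuous_on_const cl | simp)+
  also have "\<dots> \<le> integral {0..2*pi} (\<lambda>t. 1 / (h t)\<^sup>2)"
  proof (rule integral_le)
    show "exp (- M / pi) * (1 + M / pi) + (- 2 * exp (- M / pi)) * ln (h t) \<le> 1 / (h t)\<^sup>2" for t
      by (rule pt)
  qed (intro integrable_continuous_interval cl cont continuous_intros; simp add: hnz)+
  finally show ?thesis .
qed

text \<open>For \<open>F = f \<circ> exp\<close> the second derivative of the logarithmic integral
  \<open>J\<close> is \<open>K\<close>. Where \<open>|F1| \<ge> c / x j\<close>, \<open>K\<close> is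
  at least \<open>4 * (c / x j)^2\<close> times the integral of \<open>(1 + |F|^2)^-2\<close>, which
  Jensen's inequality bounds below through the upper bound on \<open>J\<close>. Then the convexity
  argument applies.\<close>

lemma hardy_space_derivative_not_large:
  fixes x :: "nat \<Rightarrow> real"
  assumes f: "f \<in> hardy_space p" and p: "0 < p"
    and x: "\<And>j. x j > 0" "x \<longlonglongrightarrow> 0"
    and c: "c > 0"
    and large: "\<forall>\<^sub>F j in sequentially. \<forall>w. Re w \<in> {-2 * x j..-x j} \<longrightarrow> cmod (exp w * deriv f (exp w)) \<ge> c / x j"
  shows False
proof -
  have hol: "f holomorphic_on unit_disc" using f by (auto simp: hardy_space_def split: if_splits)
  have hol1: "deriv f holomorphic_on unit_disc" by (rule holomorphic_deriv[OF hol]) simp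
  have hol2: "deriv (deriv f) holomorphic_on unit_disc" by (rule holomorphic_deriv[OF hol1]) simp
  define F where "F = (\<lambda>w. f (exp w))"
  define F1 where "F1 = (\<lambda>w. exp w * deriv f (exp w))"
  define F2 where "F2 = (\<lambda>w. exp w * deriv f (exp w) + exp w * (exp w * deriv (deriv f) (exp w)))"
  have ball: "exp w \<in> unit_disc" if "Re w < 0" for w using that by (simp add: norm_exp)
  have dF: "(F has_field_derivative F1 w) (at w)" if "Re w < 0" for w
    unfolding F_def F1_def using DERIV_chain2[OF holomorphic_derivI[OF hol open_ball ball[OF that]] DERIV_exp]
    by (simp add: mult.commute)
  have dF1: "(F1 has_field_derivative F2 w) (at w)" if "Re w < 0" for w
    unfolding F1_def F2_def
    using DERIV_mult[OF DERIV_exp DERIV_chain2[OF holomorphic_derivI[OF hol1 open_ball ball[OF that]] DERIV_exp]]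
    by (simp add: algebra_simps)
  have cexp: "continuous_on {w. Re w < 0} (\<lambda>w. h (exp w))" if "h holomorphic_on unit_disc" for h
    by (rule continuous_on_compose2[OF holomorphic_on_imp_continuous_on[OF that]])
       (use ball in \<open>auto intro!: continuous_intros\<close>)
  have cF2: "continuous_on {w. Re w < 0} F2"
    unfolding F2_def by (intro continuous_intros cexp hol1 hol2)
  have perF: "F (Complex s (2*pi)) = F (Complex s 0)" "F1 (Complex s (2*pi)) = F1 (Complex s 0)" for s
    by (simp_all add: F_def F1_def exp_Complex_left)
  define J where "J = (\<lambda>s. integral {0..2*pi} (\<lambda>t. ln (1 + (cmod (F (Complex s t)))\<^sup>2)))"
  define K where "K = (\<lambda>s. integral {0..2*pi}
      (\<lambda>t. 4 * (cmod (F1 (Complex s t)))\<^sup>2 / (1 + (cmod (F (Complex s t)))\<^sup>2)\<^sup>2))"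
  obtain J1 where J: "\<And>s. s < 0 \<Longrightarrow> (J has_real_derivative J1 s) (at s)"
    and J1: "\<And>s. s < 0 \<Longrightarrow> (J1 has_real_derivative K s) (at s)"
    using second_derivative_integral_ln_one_plus_norm_squared[OF dF dF1 cF2 perF]
    unfolding J_def K_def by blast
  obtain M where M: "\<And>s. s < 0 \<Longrightarrow> J s \<le> M"
    using hardy_space_ln_bounded[OF f p] unfolding J_def F_def by blast
  have slice: "continuous_on {0..2*pi} (\<lambda>t. \<Phi> (Complex s t))" if "continuous_on {w. Re w < 0} \<Phi>" "s < 0"
    for \<Phi> :: "complex \<Rightarrow> complex" and s
    by (rule continuous_on_compose2[OF that(1)])
       (use that in \<open>auto simp: Complex_eq intro!: continuous_intros\<close>)
  have cF: "continuous_on {w. Re w < 0} F" "continuous_on {w. Re w < 0} F1"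
    unfolding F_def F1_def by (intro continuous_intros cexp hol hol1)+
  have pos: "1 + (cmod z)\<^sup>2 > 0" for z :: complex by (smt (verit) zero_le_power2)
  then have nz: "1 + (cmod z)\<^sup>2 \<noteq> 0" for z :: complex by (metis less_irrefl)
  have K0: "K s \<ge> 0" if "s < 0" for s
    unfolding K_def
  proof (rule integral_nonneg)
    show "(\<lambda>t. 4 * (cmod (F1 (Complex s t)))\<^sup>2 / (1 + (cmod (F (Complex s t)))\<^sup>2)\<^sup>2) integrable_on {0..2*pi}"
      by (intro integrable_continuous_interval continuous_intros slice cF that; simp add: nz)
  qed simp
  define \<kappa> where "\<kappa> = 4 * c\<^sup>2 * (2 * pi * exp (- M / pi))"
  have "\<forall>\<^sub>F j in sequentially. \<forall>s\<in>{-2 * x j..-x j}. K s \<ge> \<kappa> / (x j)\<^sup>2"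
    using large
  proof eventually_elim
    case (elim j)
    show ?case
    proof
      fix s assume s: "s \<in> {-2 * x j..-x j}"
      then have s0: "s < 0" using x(1)[of j] by auto
      let ?d = "\<lambda>t. 1 + (cmod (F (Complex s t)))\<^sup>2"
      have cd: "continuous_on {0..2*pi} ?d" by (intro continuous_intros slice cF s0)
      have "\<kappa> / (x j)\<^sup>2 = 4 * (c / x j)\<^sup>2 * (2 * pi * exp (- M / pi))"
        by (simp add: \<kappa>_def power_divide)
      also have "\<dots> \<le> 4 * (c / x j)\<^sup>2 * integral {0..2*pi} (\<lambda>t. 1 / (?d t)\<^sup>2)"
        by (intro mult_left_mono integral_inverse_square_lower_bound cd pos)
           (use M[OF s0] in \<open>auto simp: J_def\<close>)
      also have "\<dots> = integral {0..2*pi} (\<lambda>t. 4 * (c / x j)\<^sup>2 * (1 / (?d t)\<^sup>2))"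
        by (rule integral_mult_right[symmetric])
      also have "\<dots> \<le> K s" unfolding K_def
      proof (rule integral_le)
        fix t
        have "c / x j \<le> cmod (F1 (Complex s t))" using elim s by (auto simp: F1_def)
        then have "(c / x j)\<^sup>2 \<le> (cmod (F1 (Complex s t)))\<^sup>2"
          using c x(1)[of j] by (intro power_mono) auto
        then have "4 * (c / x j)\<^sup>2 / (?d t)\<^sup>2 \<le> 4 * (cmod (F1 (Complex s t)))\<^sup>2 / (?d t)\<^sup>2"
          by (intro divide_right_mono) auto
        then show "4 * (c / x j)\<^sup>2 * (1 / (?d t)\<^sup>2) \<le> 4 * (cmod (F1 (Complex s t)))\<^sup>2 / (?d t)\<^sup>2"
          by simp
      qed (intro integrable_continuous_interval continuous_intros slice cF s0; simp add: nz)+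
      finally show "\<kappa> / (x j)\<^sup>2 \<le> K s" .
    qed
  qed
  moreover have "\<kappa> > 0" unfolding \<kappa>_def using c by simp
  ultimately show False
    using convex_bounded_above_contradiction[OF J J1 K0 M x] by blast
qed

subsection \<open>The gap series with factorial exponents\<close>

lemma sum_le_twice_last:
  fixes a :: "nat \<Rightarrow> real"
  assumes a: "\<And>j. a j > 0" "\<And>j. 2 * a j \<le> a (Suc j)"
  shows "(\<Sum>j\<le>m. a j) \<le> 2 * a m"
proof (induction m)
  case 0
  then show ?case using a(1)[of 0] by simp
next
  case (Suc m)
  then show ?case using a(2)[of m] by simp
qed

lemma sum_inverse_le_twice_first:
  fixes a :: "nat \<Rightarrow> real"
  assumes a: "\<And>j. a j > 0" "\<And>j. 2 * a j \<le> a (Suc j)"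
  shows "(\<Sum>j=m..k. 1 / a j) \<le> 2 / a m"
proof (cases "m \<le> k")
  case True
  \<comment> \<open>Keeping the term \<open>- 1 / a k\<close> makes the bound inductive, because
    doubling gives \<open>2 / a (Suc k) \<le> 1 / a k\<close>.\<close>
  then have "(\<Sum>j=m..k. 1 / a j) \<le> 2 / a m - 1 / a k"
  proof (induction k rule: dec_induct)
    case base
    then show ?case using a(1)[of m] by (simp add: field_simps)
  next
    case (step k)
    have "2 / a (Suc k) \<le> 1 / a k"
      using a(1)[of k] a(1)[of "Suc k"] a(2)[of k] by (simp add: field_simps)
    then show ?case using step by (simp add: sum.nat_ivl_Suc')
  qed
  then show ?thesis using a(1)[of k] by (smt (verit) divide_pos_pos)
next
  case False
  then show ?thesis using a(1)[of m] by simp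
qed

lemma fact_Suc_doubling: "2 * (fact (Suc j) :: real) \<le> fact (Suc (Suc j))"
  by (simp add: algebra_simps)

lemma norm_sums_le:
  fixes f :: "nat \<Rightarrow> complex"
  assumes "f sums l" "\<And>k. (\<Sum>j<k. norm (f j)) \<le> B"
  shows "norm l \<le> B"
proof (rule LIMSEQ_le_const2)
  show "(\<lambda>k. norm (\<Sum>j<k. f j)) \<longlonglongrightarrow> norm l"
    using assms(1) unfolding sums_def by (rule tendsto_norm)
  show "\<exists>N. \<forall>k\<ge>N. norm (\<Sum>j<k. f j) \<le> B"
    using assms(2) norm_sum order_trans by blast
qed

section \<open>The gap series and its Bloch seminorm\<close>

text \<open>The shift to \<open>Suc j\<close> avoids the repeated value
  \<open>fact 0 = fact 1\<close>, so every exponent is at least twice the previous one.\<close>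

definition factorial_series :: "complex \<Rightarrow> complex" where
  "factorial_series z = (\<Sum>j. z ^ fact (Suc j))"

lemma factorial_series_sums:
  assumes "z \<in> unit_disc"
  shows "(\<lambda>j. z ^ fact (Suc j)) sums factorial_series z"
    and "(\<lambda>j. of_nat (fact (Suc j)) * z ^ (fact (Suc j) - 1)) sums deriv factorial_series z"
    and "factorial_series field_differentiable at z"
proof -
  have "\<exists>g g'. \<forall>x\<in>unit_disc. (\<lambda>j. x ^ fact (Suc j)) sums g x \<and>
     (\<lambda>j. of_nat (fact (Suc j)) * x ^ (fact (Suc j) - 1)) sums g' x \<and> (g has_field_derivative g' x) (at x)"
  proof (rule series_and_derivative_comparison_local)
    fix x :: complex assume x: "x \<in> unit_disc"
    \<comment> \<open>The ball around \<open>x\<close> of radius half the distance to the circle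
      stays in \<open>cball 0 r\<close> with \<open>r < 1\<close>; since
      \<open>n \<le> fact (Suc n)\<close>, the terms there are dominated by
      \<open>r ^ n\<close>.\<close>
    define r where "r = (1 + cmod x) / 2"
    have r: "0 \<le> r" "r < 1" "cmod x + (1 - cmod x) / 2 = r" using x by (auto simp: r_def field_simps)
    have "cmod (y ^ fact (Suc n)) \<le> r ^ n" if "y \<in> ball x ((1 - cmod x) / 2)" for y n
    proof -
      have "cmod y \<le> cmod x + cmod (y - x)" by (metis norm_triangle_sub)
      moreover have "cmod (y - x) < (1 - cmod x) / 2" using that by (simp add: dist_norm norm_minus_commute)
      ultimately have y: "cmod y \<le> r" using r(3) by linarith
      have "cmod (y ^ fact (Suc n)) \<le> r ^ fact (Suc n)" using y by (simp add: norm_power power_mono)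
      also have "\<dots> \<le> r ^ n"
        by (rule power_decreasing) (use r fact_ge_self[of "Suc n"] in auto)
      finally show ?thesis .
    qed
    then show "\<exists>d h. 0 < d \<and> summable h \<and>
        (\<forall>\<^sub>F n in sequentially. \<forall>y\<in>ball x d \<inter> unit_disc. cmod (y ^ fact (Suc n)) \<le> h n)"
      using r x by (intro exI[of _ "(1 - cmod x) / 2"] exI[of _ "\<lambda>n. r ^ n"] conjI always_eventually)
        (auto intro!: summable_geometric)
  next
    fix n and x :: complex
    show "((\<lambda>x. x ^ fact (Suc n)) has_field_derivative of_nat (fact (Suc n)) * x ^ (fact (Suc n) - 1)) (at x)"
      by (auto intro!: derivative_eq_intros simp del: fact_Suc)
  qed simp
  then obtain g g' where "\<forall>x\<in>unit_disc. (\<lambda>j. x ^ fact (Suc j)) sums g x \<and>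
     (\<lambda>j. of_nat (fact (Suc j)) * x ^ (fact (Suc j) - 1)) sums g' x \<and> (g has_field_derivative g' x) (at x)"
    by (elim exE)
  then have g: "(\<lambda>j. x ^ fact (Suc j)) sums g x"
    "(\<lambda>j. of_nat (fact (Suc j)) * x ^ (fact (Suc j) - 1)) sums g' x"
    "(g has_field_derivative g' x) (at x)" if "x \<in> unit_disc" for x
    using that by blast+
  have eq: "g x = factorial_series x" if "x \<in> unit_disc" for x
    unfolding factorial_series_def using sums_unique[OF g(1)[OF that]] .
  have d: "(factorial_series has_field_derivative g' z) (at z)"
    by (rule has_field_derivative_transform_within_open[OF g(3)[OF assms] _ assms eq]) auto
  show "(\<lambda>j. z ^ fact (Suc j)) sums factorial_series z"
    using g(1)[OF assms] by (simp only: eq[OF assms])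
  show "(\<lambda>j. of_nat (fact (Suc j)) * z ^ (fact (Suc j) - 1)) sums deriv factorial_series z"
    using g(2)[OF assms] by (simp only: DERIV_imp_deriv[OF d])
  show "factorial_series field_differentiable at z"
    using d unfolding field_differentiable_def by blast
qed

text \<open>Since the exponents at least double, \<open>fact (Suc j) * r ^ (fact (Suc j) - 1)\<close> is at most twice the
  block of the geometric series between consecutive exponents.\<close>

lemma sum_fact_mult_power_le:
  fixes r :: real
  assumes r: "0 \<le> r" "r < 1"
  shows "(\<Sum>j<k. fact (Suc j) * r ^ (fact (Suc j) - 1)) \<le> 2 / (1 - r)"
proof -
  \<comment> \<open>The first \<open>Suc k\<close> terms are compared with the powers below the last
    exponent \<open>fact (Suc k)\<close>; the extra term, which is nonnegative, is dropped at the
    end.\<close>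
  have "(\<Sum>j<Suc k. fact (Suc j) * r ^ (fact (Suc j) - 1)) \<le> 2 * (\<Sum>m<fact (Suc k). r ^ m)"
  proof (induction k)
    case 0
    show ?case by simp
  next
    case (Suc k)
    let ?a = "fact (Suc k) :: nat" and ?b = "fact (Suc (Suc k)) :: nat"
    have ab: "2 * ?a \<le> ?b" by simp
    have "real ?b * r ^ (?b - 1) \<le> 2 * (real (?b - ?a) * r ^ (?b - 1))"
      using ab r by (simp only: mult.assoc[symmetric]) (intro mult_right_mono, auto)
    also have "real (?b - ?a) * r ^ (?b - 1) = (\<Sum>m=?a..<?b. r ^ (?b - 1))" by simp
    also have "\<dots> \<le> (\<Sum>m=?a..<?b. r ^ m)"
      by (intro sum_mono power_decreasing) (use r in auto)
    finally have *: "fact (Suc (Suc k)) * r ^ (?b - 1) \<le> 2 * (\<Sum>m=?a..<?b. r ^ m)"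
      by (simp only: of_nat_fact mult_left_mono)
    have "(\<Sum>m<?b. r ^ m) = (\<Sum>m<?a. r ^ m) + (\<Sum>m=?a..<?b. r ^ m)"
      using ab by (simp only: lessThan_atLeast0) (rule sum.atLeastLessThan_concat[symmetric], auto)
    then show ?case
      using add_mono[OF Suc *] by (simp only: sum.lessThan_Suc[of _ "Suc k"] distrib_left)
  qed
  moreover have "(\<Sum>m<fact (Suc k). r ^ m) \<le> 1 / (1 - r)"
    using r by (simp add: sum_gp_strict divide_right_mono)
  moreover have "(\<Sum>j<k. fact (Suc j) * r ^ (fact (Suc j) - 1)) \<le> (\<Sum>j<Suc k. fact (Suc j) * r ^ (fact (Suc j) - 1))"
    using r by simp
  ultimately show ?thesis by linarith
qed

lemma factorial_series_in_bloch_space: "factorial_series \<in> bloch_space"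
proof -
  have "(1 - (cmod z)\<^sup>2) * cmod (deriv factorial_series z) \<le> 4" if z: "z \<in> unit_disc" for z
  proof -
    have "cmod (deriv factorial_series z) \<le> 2 / (1 - cmod z)"
      by (rule norm_sums_le[OF factorial_series_sums(2)[OF z]])
        (use z sum_fact_mult_power_le[of "cmod z"] in \<open>simp add: norm_mult norm_power del: fact_Suc\<close>)
    then have "(1 - (cmod z)\<^sup>2) * cmod (deriv factorial_series z) \<le> (1 - (cmod z)\<^sup>2) * (2 / (1 - cmod z))"
      using z by (intro mult_left_mono) (auto simp: abs_square_le_1 power_le_one)
    also have "\<dots> = 2 * (1 + cmod z)" using z by (simp add: field_simps power2_eq_square)
    also have "\<dots> \<le> 4" using z by simp
    finally show ?thesis .
  qed
  then have "bloch_seminorm factorial_series \<le> ennreal 4"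
    unfolding bloch_seminorm_def by (intro SUP_least ennreal_leI)
  then have "bloch_seminorm factorial_series < \<infinity>"
    using le_less_trans ennreal_less_top unfolding infinity_ennreal_def by blast
  moreover have "factorial_series holomorphic_on unit_disc"
    using factorial_series_sums(3) by (auto simp: holomorphic_on_def field_differentiable_at_within)
  ultimately show ?thesis by (simp add: bloch_space_def)
qed

section \<open>Hyperbolic distance and the growth estimate\<close>

text \<open>Divided by \<open>(cmod (1 - cnj z * w))^2\<close> this is the standard formula for
  \<open>1 - \<rho>^2\<close>, where \<open>\<rho>\<close> is the pseudohyperbolic distance of
  \<open>z\<close> and \<open>w\<close>.\<close>

lemma norm_one_minus_cnj_mult:
  "(cmod (1 - cnj z * w))\<^sup>2 - (cmod (z - w))\<^sup>2 = (1 - (cmod z)\<^sup>2) * (1 - (cmod w)\<^sup>2)"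
  unfolding cmod_power2 by (simp add: algebra_simps power2_eq_square)

lemma hyperbolic_dist_commute: "hyperbolic_dist z w = hyperbolic_dist w z"
proof -
  have "cmod (1 - cnj z * w) = cmod (cnj (1 - cnj z * w))" by (simp only: complex_mod_cnj)
  also have "cnj (1 - cnj z * w) = 1 - cnj w * z" by (simp add: mult.commute)
  finally show ?thesis
    by (simp add: hyperbolic_dist_def disc_automorphism_def norm_divide norm_minus_commute)
qed

text \<open>Here \<open>exp (2 * hyperbolic_dist z w) = (1 + \<rho>) / (1 - \<rho>) \<ge> 1 / (1 -
  \<rho>)\<close> for \<open>\<rho> = d / q\<close>. The identity above and
  \<open>1 - cmod w \<le> q\<close> give \<open>(1 - \<rho>) * q \<le> 4 * (1 - cmod z)\<close>, and
  \<open>d < q\<close>.\<close>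

lemma hyperbolic_dist_lower_bounds:
  assumes z: "z \<in> unit_disc" and w: "w \<in> unit_disc"
  shows "0 \<le> hyperbolic_dist z w"
    and "z \<noteq> w \<Longrightarrow> ln (cmod (z - w) / (1 - cmod z)) \<le> 2 * hyperbolic_dist z w + ln 4"
proof -
  define q where "q = cmod (1 - cnj z * w)"
  define d where "d = cmod (z - w)"
  define \<rho> where "\<rho> = cmod (disc_automorphism z w)"
  have zw: "cmod z < 1" "cmod w < 1" using z w by auto
  have \<rho>: "\<rho> = d / q" by (simp add: \<rho>_def d_def q_def disc_automorphism_def norm_divide)
  have "cmod (cnj z * w) \<le> cmod w" using zw by (simp add: norm_mult mult_left_le_one_le)
  moreover have "1 \<le> q + cmod (cnj z * w)"
    unfolding q_def using norm_triangle_ineq[of "1 - cnj z * w" "cnj z * w"] by simp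
  ultimately have q: "1 - cmod w \<le> q" "0 < q" using zw by linarith+
  have sq: "q\<^sup>2 - d\<^sup>2 = (1 - (cmod z)\<^sup>2) * (1 - (cmod w)\<^sup>2)"
    unfolding q_def d_def by (rule norm_one_minus_cnj_mult)
  have pos: "0 < 1 - (cmod z)\<^sup>2" "0 < 1 - (cmod w)\<^sup>2"
    using zw by (simp_all add: power_less_one_iff abs_square_less_1)
  have "d\<^sup>2 < q\<^sup>2" using sq mult_pos_pos[OF pos] by linarith
  then have dq: "d < q" using q(2) by (meson less_imp_le power2_less_imp_less)
  have d0: "0 \<le> d" by (simp add: d_def)
  have \<rho>01: "0 \<le> \<rho>" "\<rho> < 1" using dq d0 q by (auto simp: \<rho>)
  have two: "2 * hyperbolic_dist z w = ln ((1 + \<rho>) / (1 - \<rho>))"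
    by (simp add: hyperbolic_dist_def \<rho>_def)
  have "1 \<le> (1 + \<rho>) / (1 - \<rho>)" using \<rho>01 by (simp add: field_simps)
  then have "0 \<le> ln ((1 + \<rho>) / (1 - \<rho>))" by (rule ln_ge_zero)
  then show "0 \<le> hyperbolic_dist z w" using two by linarith
  assume "z \<noteq> w"
  then have d: "d > 0" by (simp add: d_def)
  let ?h = "1 - cmod z"
  have h: "?h > 0" using zw by simp
  \<comment> \<open>Enlarging \<open>q\<close> to \<open>q + d\<close> brings in the identity for
    \<open>q^2 - d^2\<close>; its factor \<open>1 - cmod w\<close> is at most \<open>q\<close>,
    which cancels one \<open>q\<close> on the left.\<close>
  have "(1 - \<rho>) * (q * q) = (q - d) * q" using q by (simp add: \<rho> field_simps)
  also have "\<dots> \<le> (q - d) * (q + d)" using dq d0 by (intro mult_left_mono) auto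
  also have "\<dots> = q\<^sup>2 - d\<^sup>2" by (simp add: power2_eq_square algebra_simps)
  also have "\<dots> = (?h * (1 + cmod z)) * ((1 - cmod w) * (1 + cmod w))"
    unfolding sq by (simp add: power2_eq_square algebra_simps)
  also have "\<dots> \<le> (?h * 2) * (q * 2)"
    using zw q by (intro mult_mono) auto
  finally have "(1 - \<rho>) * q * q \<le> 4 * ?h * q" by (simp add: mult_ac)
  then have "(1 - \<rho>) * q \<le> 4 * ?h" using q by simp
  moreover have "(1 - \<rho>) * d \<le> (1 - \<rho>) * q" using dq \<rho>01 by (intro mult_left_mono) auto
  ultimately have "(1 - \<rho>) * d \<le> 4 * ?h" by linarith
  then have "d / ?h \<le> 4 / (1 - \<rho>)" using h \<rho>01 by (simp add: field_simps)
  also have "\<dots> \<le> 4 * ((1 + \<rho>) / (1 - \<rho>))"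
    using \<rho>01 by (simp add: divide_right_mono)
  finally have "ln (d / ?h) \<le> ln (4 * ((1 + \<rho>) / (1 - \<rho>)))"
    using d h \<rho>01 by (intro ln_mono) auto
  also have "\<dots> = ln 4 + ln ((1 + \<rho>) / (1 - \<rho>))"
    using \<rho>01 by (intro ln_mult_pos) auto
  finally show "ln (cmod (z - w) / (1 - cmod z)) \<le> 2 * hyperbolic_dist z w + ln 4"
    using two by (simp add: d_def)
qed

lemma sum_Un_le:
  fixes f :: "'a \<Rightarrow> real"
  assumes "finite A" "finite B" "\<And>x. f x \<ge> 0"
  shows "sum f (A \<union> B) \<le> sum f A + sum f B"
  using sum.union_inter[OF assms(1,2), of f] sum_nonneg[of "A \<inter> B" f] assms(3) by simp

text \<open>From the least index \<open>m\<close> to the greatest index \<open>M\<close> in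
  \<open>S\<close> the values grow at least by the factor \<open>exp (L * (M - m))\<close>, yet by
  less than \<open>v / u\<close>. So \<open>M - m \<le> B / L\<close>, and the summand
  \<open>1\<close> comes from counting both end points.\<close>

lemma card_window_le:
  fixes a :: "nat \<Rightarrow> real"
  assumes a: "\<And>j. a j > 0" and ratio: "\<And>j. N \<le> j \<Longrightarrow> exp L * a j \<le> a (Suc j)"
    and L: "0 < L" and fin: "finite S" and S: "\<And>j. j \<in> S \<Longrightarrow> N \<le> j"
    and win: "\<And>j. j \<in> S \<Longrightarrow> u < a j \<and> a j < v" and u: "0 < u" "0 \<le> B" "ln (v / u) \<le> B"
  shows "real (card S) \<le> 1 + B / L"
proof (cases "S = {}")
  case True
  then show ?thesis using u L by simp
next
  case False
  define m M where "m = Min S" and "M = Max S"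
  have mM: "m \<in> S" "M \<in> S" "m \<le> M" using False fin by (auto simp: m_def M_def)
  have pow: "exp (L * real k) * a m \<le> a (m + k)" for k
  proof (induction k)
    case (Suc k)
    have "exp (L * real (Suc k)) * a m = exp L * (exp (L * real k) * a m)"
      by (simp add: exp_add algebra_simps)
    also have "\<dots> \<le> exp L * a (m + k)" using Suc by simp
    also have "\<dots> \<le> a (m + Suc k)" using ratio[of "m + k"] S[OF mM(1)] by simp
    finally show ?case .
  qed simp
  have "exp (L * real (M - m)) * u \<le> exp (L * real (M - m)) * a m"
    using win[OF mM(1)] by (intro mult_left_mono) auto
  also have "\<dots> \<le> a M" using pow[of "M - m"] mM(3) by simp
  also have "\<dots> \<le> v" using win[OF mM(2)] by simp
  finally have "exp (L * real (M - m)) \<le> v / u" using u by (simp add: pos_le_divide_eq)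
  then have "L * real (M - m) \<le> ln (v / u)"
    by (metis exp_gt_zero ln_exp ln_mono)
  then have "real (M - m) \<le> B / L" using L u by (simp add: pos_le_divide_eq mult.commute)
  moreover have "S \<subseteq> {m..M}" using fin by (auto simp: m_def M_def)
  then have "card S \<le> Suc M - m" using card_mono[of "{m..M}" S] by simp
  then have "real (card S) \<le> 1 + real (M - m)" using mM(3) by linarith
  ultimately show ?thesis by linarith
qed

text \<open>The terms of the difference split into four groups: indices below \<open>N\<close>,
  where the ratios may still be small, exponents up to \<open>1 / d\<close>, exponents from
  \<open>1 / h\<close> on, and the window in between. They contribute at most \<open>2 * N\<close>,
  \<open>2\<close>, \<open>4\<close> and \<open>2 * (1 + B / L)\<close>.\<close>

lemma norm_factorial_series_diff_le:
  assumes z: "z \<in> unit_disc" and w: "w \<in> unit_disc" and le: "cmod w \<le> cmod z"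
    and L: "0 < L" and N: "\<And>j. N \<le> j \<Longrightarrow> exp L \<le> real j + 2"
  shows "cmod (factorial_series z - factorial_series w)
    \<le> 2 * real N + 8 + 2 * (2 * hyperbolic_dist z w + ln 4) / L"
proof (cases "z = w")
  case True
  then show ?thesis using hyperbolic_dist_lower_bounds(1)[OF z w] L by simp
next
  case False
  define a :: "nat \<Rightarrow> real" where "a = (\<lambda>i. fact (Suc i))"
  have a: "a i > 0" "2 * a i \<le> a (Suc i)" for i
    unfolding a_def using fact_Suc_doubling by (auto simp del: fact_Suc)
  have a_ratio: "a (Suc i) = (real i + 2) * a i" for i by (simp add: a_def algebra_simps)
  define d h where "d = cmod (z - w)" and "h = 1 - cmod z"
  have d: "d > 0" and h: "h > 0" using False z by (auto simp: d_def h_def)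
  define B where "B = 2 * hyperbolic_dist z w + ln 4"
  have B: "0 \<le> B" "ln (d / h) \<le> B"
    using hyperbolic_dist_lower_bounds[OF z w] False by (auto simp: B_def d_def h_def)
  define T where "T = (\<lambda>j. cmod (z ^ fact (Suc j) - w ^ fact (Suc j)))"
  have T0: "T j \<ge> 0" for j by (simp add: T_def)
  have T1: "T j \<le> a j * d" for j
    unfolding T_def a_def d_def using norm_power_diff[of z w "fact (Suc j)"] z w
    by (simp del: fact_Suc)
  have T2: "T j \<le> 2 * cmod z ^ fact (Suc j)" for j
  proof -
    have "T j \<le> cmod z ^ fact (Suc j) + cmod w ^ fact (Suc j)"
      unfolding T_def by (metis norm_power norm_triangle_ineq4)
    also have "cmod w ^ fact (Suc j) \<le> cmod z ^ fact (Suc j)" using le by (intro power_mono) auto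
    finally show ?thesis by simp
  qed
  have T3: "T j \<le> 2" for j
    using T2[of j] power_le_one[of "cmod z" "fact (Suc j)"] z by simp
  \<comment> \<open>From \<open>cmod z = 1 - h \<le> exp (- h)\<close> and
    \<open>y \<le> exp y\<close> at \<open>y = a j * h\<close> it follows that
    \<open>cmod z ^ fact (Suc j) \<le> 1 / (a j * h)\<close>.\<close>
  have T4: "T j \<le> 2 / h * (1 / a j)" for j
  proof -
    have "cmod z \<le> exp (- h)" using exp_ge_add_one_self[of "- h"] by (simp add: h_def)
    then have "cmod z ^ fact (Suc j) \<le> exp (- h) ^ fact (Suc j)" by (intro power_mono) auto
    also have "\<dots> = exp (- (a j * h))" by (simp add: exp_of_nat_mult[symmetric] a_def del: fact_Suc)
    also have "\<dots> \<le> 1 / (a j * h)"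
    proof -
      have "a j * h \<le> exp (a j * h)" using exp_ge_add_one_self[of "a j * h"] by linarith
      then show ?thesis using a(1)[of j] h by (simp add: exp_minus field_simps)
    qed
    finally show ?thesis using T2[of j] by (simp add: field_simps)
  qed
  have "cmod (factorial_series z - factorial_series w) \<le> 2 * real N + 8 + 2 * B / L"
  proof (rule norm_sums_le[OF sums_diff[OF factorial_series_sums(1)[OF z] factorial_series_sums(1)[OF w]]])
    fix K
    define S1 where "S1 = {j\<in>{..<K}. a j * d \<le> 1}"
    define S2 where "S2 = {j\<in>{..<K}. 1 \<le> a j * h}"
    define S3 where "S3 = {j\<in>{..<K}. N \<le> j \<and> 1 / d < a j \<and> a j < 1 / h}"
    have fin: "finite S1" "finite S2" "finite S3" by (auto simp: S1_def S2_def S3_def)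
    have sub: "{..<K} \<subseteq> ({..<N} \<union> S1) \<union> (S2 \<union> S3)"
      unfolding S1_def S2_def S3_def using d h by (auto simp: field_simps)
    have "sum T {..<K} \<le> sum T (({..<N} \<union> S1) \<union> (S2 \<union> S3))"
      using sub fin T0 by (intro sum_mono2) auto
    also have "\<dots> \<le> (sum T {..<N} + sum T S1) + (sum T S2 + sum T S3)"
      using fin T0 by (intro order_trans[OF sum_Un_le] add_mono sum_Un_le) auto
    also have "sum T {..<N} \<le> 2 * real N"
      using sum_bounded_above[of "{..<N}" T 2] T3 by (simp add: mult.commute)
    \<comment> \<open>By doubling, the sum is at most twice the value at the last index of
      \<open>S1\<close>, where \<open>a j * d \<le> 1\<close>.\<close>
    also have "sum T S1 \<le> 2"
    proof (cases "S1 = {}")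
      case False
      have "sum T S1 \<le> (\<Sum>j\<in>S1. a j * d)" by (intro sum_mono T1)
      also have "\<dots> \<le> (\<Sum>j\<le>Max S1. a j * d)"
        using fin a(1) d by (intro sum_mono2) (auto simp: less_imp_le)
      also have "\<dots> = (\<Sum>j\<le>Max S1. a j) * d" by (rule sum_distrib_right[symmetric])
      also have "\<dots> \<le> 2 * a (Max S1) * d"
        using d by (intro mult_right_mono sum_le_twice_last a) auto
      also have "\<dots> \<le> 2" using Max_in[OF fin(1) False] by (auto simp: S1_def)
      finally show ?thesis .
    qed simp
    \<comment> \<open>Dually, the reciprocals are dominated by the first one, at an index where
      \<open>1 \<le> a j * h\<close>.\<close>
    also have "sum T S2 \<le> 4"
    proof (cases "S2 = {}")
      case False
      have "sum T S2 \<le> (\<Sum>j\<in>S2. 2 / h * (1 / a j))" by (intro sum_mono T4)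
      also have "\<dots> \<le> (\<Sum>j=Min S2..K. 2 / h * (1 / a j))"
      proof (rule sum_mono2)
        show "S2 \<subseteq> {Min S2..K}" using fin by (auto simp: S2_def)
        show "0 \<le> 2 / h * (1 / a j)" for j using a(1)[of j] h by simp
      qed simp
      also have "\<dots> = 2 / h * (\<Sum>j=Min S2..K. 1 / a j)" by (rule sum_distrib_left[symmetric])
      also have "\<dots> \<le> 2 / h * (2 / a (Min S2))"
        using h by (intro mult_left_mono sum_inverse_le_twice_first a) auto
      also have "\<dots> \<le> 4"
      proof -
        have "1 \<le> a (Min S2) * h" using Min_in[OF fin(2) False] by (auto simp: S2_def)
        then show ?thesis using a(1)[of "Min S2"] h by (simp add: field_simps)
      qed
      finally show ?thesis .
    qed simp
    also have "sum T S3 \<le> 2 * (1 + B / L)"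
    proof -
      have "real (card S3) \<le> 1 + B / L"
      proof (rule card_window_le[of a N L S3 "1 / d" "1 / h" B])
        show "exp L * a j \<le> a (Suc j)" if "N \<le> j" for j
          unfolding a_ratio using N[OF that] a(1)[of j] by (intro mult_right_mono) auto
      qed (use a L fin d h B in \<open>auto simp: S3_def\<close>)
      then show ?thesis using sum_bounded_above[of S3 T 2] T3 by (smt (verit) mult.commute)
    qed
    finally show "(\<Sum>j<K. cmod (z ^ fact (Suc j) - w ^ fact (Suc j))) \<le> 2 * real N + 8 + 2 * B / L"
      unfolding T_def by simp
  qed
  then show ?thesis by (simp add: B_def)
qed

lemma factorial_series_growth:
  assumes "\<epsilon> > 0"
  shows "\<exists>C>0. \<forall>z\<in>unit_disc. \<forall>w\<in>unit_disc.
    cmod (factorial_series z - factorial_series w) \<le> C + \<epsilon> * hyperbolic_dist z w"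
proof -
  \<comment> \<open>With this \<open>L\<close> the term
    \<open>2 * (2 * hyperbolic_dist z w) / L\<close> is
    \<open>\<epsilon> * hyperbolic_dist z w\<close>; a large \<open>N\<close> then makes all later
    ratios \<open>j + 2\<close> at least \<open>exp L\<close>.\<close>
  define L where "L = 4 / \<epsilon>"
  have L: "L > 0" using assms by (simp add: L_def)
  obtain N :: nat where "exp L \<le> real N" using real_arch_simple by blast
  then have N: "exp L \<le> real j + 2" if "N \<le> j" for j using that by simp
  define C where "C = 2 * real N + 8 + 2 * ln 4 / L"
  have bound: "cmod (factorial_series z - factorial_series w) \<le> C + \<epsilon> * hyperbolic_dist z w"
    if "z \<in> unit_disc" "w \<in> unit_disc" "cmod w \<le> cmod z" for z w
  proof -
    have "2 * (2 * hyperbolic_dist z w + ln 4) / L = \<epsilon> * hyperbolic_dist z w + 2 * ln 4 / L"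
      using assms by (simp add: L_def field_simps)
    then show ?thesis
      using norm_factorial_series_diff_le[of z w L N, OF that L N] unfolding C_def by linarith
  qed
  have "C > 0" unfolding C_def using L by (simp add: add_pos_nonneg)
  \<comment> \<open>Both sides are symmetric in \<open>z\<close> and \<open>w\<close>, so the case
    \<open>cmod w \<le> cmod z\<close> suffices.\<close>
  then show ?thesis
    using bound by (metis hyperbolic_dist_commute linear norm_minus_commute)
qed

section \<open>The derivative on the strips and the Bloch closure\<close>

text \<open>On the strip the term of index \<open>j\<close> has modulus at least
  \<open>exp (-2) * fact (Suc j)\<close>. All earlier terms together are at most
  \<open>2 / (j + 1)\<close> times \<open>fact (Suc j)\<close>, because doubling lets the last of
  them dominate, and all later ones at most \<open>4 / (j + 2)\<close> times it.\<close>

lemma deriv_factorial_series_lower_bound: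
  assumes j: "0 < j" and w: "Re w \<in> {-2 / fact (Suc j)..-1 / fact (Suc j)}"
  shows "(exp (-2) - 6 / (real j + 1)) * fact (Suc j) \<le> cmod (exp w * deriv factorial_series (exp w))"
proof -
  define a :: "nat \<Rightarrow> real" where "a = (\<lambda>i. fact (Suc i))"
  have a: "a i > 0" "2 * a i \<le> a (Suc i)" for i
    unfolding a_def using fact_Suc_doubling by (auto simp del: fact_Suc)
  define x where "x = - Re w"
  have x: "1 / a j \<le> x" "x \<le> 2 / a j" using w by (auto simp: a_def x_def simp del: fact_Suc)
  have xpos: "x > 0" using x(1) a(1)[of j] by (smt (verit) divide_pos_pos)
  have z: "exp w \<in> unit_disc" using xpos by (simp add: x_def norm_exp)
  let ?u = "\<lambda>i. of_nat (fact (Suc i)) * exp w ^ fact (Suc i)"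
  have "(\<lambda>i. exp w * (of_nat (fact (Suc i)) * exp w ^ (fact (Suc i) - 1))) sums (exp w * deriv factorial_series (exp w))"
    by (rule sums_mult[OF factorial_series_sums(2)[OF z]])
  moreover have "exp w * (of_nat (fact (Suc i)) * exp w ^ (fact (Suc i) - 1)) = ?u i" for i
    by (simp add: power_eq_if del: fact_Suc)
  ultimately have "?u sums (exp w * deriv factorial_series (exp w))" by (simp only:)
  from sums_diff[OF this sums_single[of j ?u]]
  have s: "(\<lambda>i. ?u i - (if i = j then ?u i else 0)) sums (exp w * deriv factorial_series (exp w) - ?u j)" .
  have nu: "cmod (?u i) = a i * exp (- (a i * x))" for i
    by (simp add: norm_mult norm_power norm_exp exp_of_nat_mult[symmetric] a_def x_def del: fact_Suc)
  have early: "cmod (?u i) \<le> a i" for i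
    unfolding nu by (rule mult_left_le) (use a(1)[of i] xpos in auto)
  \<comment> \<open>The quadratic bound \<open>y^2 / 2 \<le> exp y\<close> is what makes the later
    terms summable: the linear bound \<open>y \<le> exp y\<close> would only bound each of them by
    \<open>a j\<close>.\<close>
  have late: "cmod (?u i) \<le> 2 * (a j)\<^sup>2 * (1 / a i)" for i
  proof -
    have "0 \<le> a i / a j" using a(1)[of i] a(1)[of j] by simp
    from exp_lower_Taylor_quadratic[OF this] this have "(a i / a j)\<^sup>2 / 2 \<le> exp (a i / a j)"
      by linarith
    also have "\<dots> \<le> exp (a i * x)"
      using mult_left_mono[OF x(1), of "a i"] a(1)[of i] by simp
    finally have "(a i)\<^sup>2 \<le> 2 * (a j)\<^sup>2 * exp (a i * x)"
      using a(1)[of j] by (simp add: field_simps)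
    then show ?thesis unfolding nu using a(1)[of i]
      by (simp add: exp_minus field_simps power2_eq_square)
  qed
  have "cmod (exp w * deriv factorial_series (exp w) - ?u j) \<le> 6 * a j / (real j + 1)"
  proof (rule norm_sums_le[OF s])
    fix k
    have "(\<Sum>i<k. cmod (?u i - (if i = j then ?u i else 0))) = (\<Sum>i\<in>{..<k} - {j}. cmod (?u i - (if i = j then ?u i else 0)))"
      by (rule sum.mono_neutral_right) auto
    also have "\<dots> = (\<Sum>i\<in>{..<k} - {j}. cmod (?u i))"
      by (rule sum.cong) auto
    \<comment> \<open>Since \<open>0 < j\<close>, the truncated difference \<open>j - 1\<close> is
      really below \<open>j\<close>, so the two ranges omit \<open>j\<close>.\<close>
    also have "\<dots> \<le> (\<Sum>i\<in>{..j-1} \<union> {Suc j..k}. cmod (?u i))"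
      by (rule sum_mono2) auto
    also have "\<dots> = (\<Sum>i\<le>j-1. cmod (?u i)) + (\<Sum>i=Suc j..k. cmod (?u i))"
      by (rule sum.union_disjoint) (use j in auto)
    also have "\<dots> \<le> (\<Sum>i\<le>j-1. a i) + (\<Sum>i=Suc j..k. 2 * (a j)\<^sup>2 * (1 / a i))"
      by (intro add_mono sum_mono early late)
    also have "\<dots> = (\<Sum>i\<le>j-1. a i) + 2 * (a j)\<^sup>2 * (\<Sum>i=Suc j..k. 1 / a i)"
      by (simp add: sum_distrib_left)
    also have "\<dots> \<le> 2 * a (j - 1) + 2 * (a j)\<^sup>2 * (2 / a (Suc j))"
      by (intro add_mono mult_left_mono sum_le_twice_last sum_inverse_le_twice_first a) auto
    also have "a (j - 1) = a j / (real j + 1)"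
      using j by (cases j) (simp_all add: a_def field_simps)
    also have "2 * (a j)\<^sup>2 * (2 / a (Suc j)) = 4 * a j / (real j + 2)"
    proof -
      have "a (Suc j) = (real j + 2) * a j" by (simp add: a_def algebra_simps)
      then show ?thesis using a(1)[of j] by (simp add: power2_eq_square)
    qed
    also have "4 * a j / (real j + 2) \<le> 4 * a j / (real j + 1)"
      by (intro divide_left_mono) (use a(1)[of j] in auto)
    finally show "(\<Sum>i<k. cmod (?u i - (if i = j then ?u i else 0))) \<le> 6 * a j / (real j + 1)"
      by (simp add: add_divide_distrib[symmetric])
  qed
  moreover have "cmod (?u j) \<ge> a j * exp (-2)"
    unfolding nu using x(2) a(1)[of j] by (intro mult_left_mono) (auto simp: field_simps)
  moreover have "cmod (?u j) - cmod (exp w * deriv factorial_series (exp w) - ?u j) \<le> cmod (exp w * deriv factorial_series (exp w))"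
    by (metis norm_minus_commute norm_triangle_sub add.commute diff_le_eq)
  ultimately have "a j * exp (-2) - 6 * a j / (real j + 1) \<le> cmod (exp w * deriv factorial_series (exp w))"
    by linarith
  then show ?thesis by (simp add: a_def algebra_simps del: fact_Suc)
qed

lemma bloch_seminorm_lessD:
  assumes "bloch_seminorm h < ennreal e" "z \<in> unit_disc"
  shows "(1 - (cmod z)\<^sup>2) * cmod (deriv h z) \<le> e"
proof -
  have "ennreal ((1 - (cmod z)\<^sup>2) * cmod (deriv h z)) \<le> bloch_seminorm h"
    unfolding bloch_seminorm_def by (rule SUP_upper[OF assms(2)])
  then have "ennreal ((1 - (cmod z)\<^sup>2) * cmod (deriv h z)) < ennreal e"
    using assms(1) by order
  then show ?thesis using ennreal_leI linorder_not_less less_imp_le by (metis linear)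
qed

text \<open>In the coordinate \<open>w\<close> the Bloch weight becomes the distance to the
  imaginary axis: for \<open>r = exp (Re w)\<close>, the inequality
  \<open>1 - Re w \<le> exp (- Re w)\<close> gives
  \<open>r * (- Re w) \<le> 1 - r \<le> 1 - r^2\<close>.\<close>

lemma norm_exp_mult_le_if_bloch:
  assumes "(1 - (cmod (exp w))\<^sup>2) * cmod d \<le> e" "Re w < 0" "0 < e"
  shows "cmod (exp w * d) \<le> e / (- Re w)"
proof -
  let ?r = "exp (Re w)"
  have r: "0 < ?r" "?r < 1" using assms(2) by auto
  have "1 + (- Re w) \<le> exp (- Re w)" by (rule exp_ge_add_one_self)
  then have 1: "?r * (- Re w) \<le> 1 - ?r"
    using r by (simp add: exp_minus field_simps)
  have "(1 - ?r) * cmod d \<le> (1 - ?r\<^sup>2) * cmod d"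
    using r by (intro mult_right_mono) (auto simp: power2_eq_square)
  also have "\<dots> \<le> e" using assms(1) by (simp add: norm_exp)
  finally have "(1 - ?r) * cmod d \<le> e" .
  moreover have "?r * (- Re w) * cmod d \<le> (1 - ?r) * cmod d"
    by (rule mult_right_mono[OF 1]) simp
  ultimately have "?r * cmod d * (- Re w) \<le> e" by (simp add: mult_ac)
  then show ?thesis using assms(2) by (simp add: norm_mult norm_exp pos_le_divide_eq field_simps)
qed

lemma factorial_series_not_in_bloch_closure:
  assumes p: "0 < p"
  shows "factorial_series \<notin> bloch_closure (hardy_space p \<inter> bloch_space)"
proof
  assume *: "factorial_series \<in> bloch_closure (hardy_space p \<inter> bloch_space)"
  \<comment> \<open>With \<open>n = fact (Suc j)\<close>, the main term on the strip is at least
    \<open>4 * e * n\<close>, the other terms eventually cost less than \<open>2 * e * n\<close>,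
    and passing to \<open>f\<close> costs at most \<open>e * n\<close>; this leaves
    \<open>e * n = e / x j\<close>.\<close>
  define e :: real where "e = exp (-2) / 4"
  have e: "e > 0" by (simp add: e_def)
  from * e obtain f where f: "f \<in> hardy_space p" "f \<in> bloch_space"
    and close: "bloch_seminorm (\<lambda>z. factorial_series z - f z) < ennreal e"
    unfolding bloch_closure_def by blast
  have hol: "f holomorphic_on unit_disc" using f(2) by (simp add: bloch_space_def)
  define x :: "nat \<Rightarrow> real" where "x = (\<lambda>j. 1 / fact (Suc j))"
  have x: "x j > 0" for j by (simp add: x_def)
  have "x \<longlonglongrightarrow> 0"
  proof (rule tendsto_sandwich[OF _ _ tendsto_const LIMSEQ_inverse_real_of_nat])
    show "\<forall>\<^sub>F j in sequentially. x j \<le> inverse (real (Suc j))"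
    proof (intro always_eventually allI)
      fix j
      have "real (Suc j) \<le> fact (Suc j)"
        using fact_ge_self[of "Suc j"] of_nat_mono by (metis of_nat_fact)
      then show "x j \<le> inverse (real (Suc j))"
        unfolding x_def by (simp add: divide_inverse le_imp_inverse_le del: fact_Suc of_nat_Suc)
    qed
  qed (use x in \<open>simp add: less_imp_le\<close>)
  moreover have "\<forall>\<^sub>F j in sequentially. \<forall>w. Re w \<in> {-2 * x j..-x j} \<longrightarrow> cmod (exp w * deriv f (exp w)) \<ge> e / x j"
  proof -
    have "(\<lambda>j. 6 / (real j + 1)) \<longlonglongrightarrow> 0" by real_asymp
    then have "\<forall>\<^sub>F j in sequentially. 6 / (real j + 1) < 2 * e"
      by (rule order_tendstoD) (use e in simp)
    then show ?thesis using eventually_gt_at_top[of 0]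
    proof eventually_elim
      case (elim j)
      show ?case
      proof (intro allI impI)
        fix w assume w: "Re w \<in> {-2 * x j..-x j}"
        then have Re: "Re w < 0" "x j \<le> - Re w" using x[of j] by auto
        then have z: "exp w \<in> unit_disc" by (simp add: norm_exp)
        have "deriv (\<lambda>z. factorial_series z - f z) (exp w) = deriv factorial_series (exp w) - deriv f (exp w)"
          by (rule deriv_diff)
            (use z hol factorial_series_sums(3) in \<open>auto intro: holomorphic_on_imp_differentiable_at\<close>)
        then have "cmod (exp w * (deriv factorial_series (exp w) - deriv f (exp w))) \<le> e / (- Re w)"
          using norm_exp_mult_le_if_bloch[OF _ Re(1) e] bloch_seminorm_lessD[OF close z] by simp
        also have "\<dots> \<le> e / x j" by (rule frac_le) (use Re x[of j] e in auto)
        finally have 1: "cmod (exp w * deriv factorial_series (exp w) - exp w * deriv f (exp w)) \<le> e / x j"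
          by (simp add: right_diff_distrib)
        have "2 * e \<le> exp (-2) - 6 / (real j + 1)" using elim(1) unfolding e_def by linarith
        then have "2 * e * (1 / x j) \<le> (exp (-2) - 6 / (real j + 1)) * (1 / x j)"
          by (rule mult_right_mono) (simp add: x_def)
        then have "e / x j + e / x j \<le> (exp (-2) - 6 / (real j + 1)) * (1 / x j)" by simp
        also have "\<dots> \<le> cmod (exp w * deriv factorial_series (exp w))"
          using deriv_factorial_series_lower_bound[OF elim(2), of w] w by (simp add: x_def del: fact_Suc)
        finally have "e / x j + e / x j \<le> cmod (exp w * deriv factorial_series (exp w))" .
        moreover have "cmod (exp w * deriv factorial_series (exp w)) \<le> cmod (exp w * deriv f (exp w))
            + cmod (exp w * deriv factorial_series (exp w) - exp w * deriv f (exp w))"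
          by (rule norm_triangle_sub)
        ultimately show "e / x j \<le> cmod (exp w * deriv f (exp w))" using 1 by linarith
      qed
    qed
  qed
  ultimately show False
    using hardy_space_derivative_not_large[of f p x e, OF f(1) p x _ e] by blast
qed

theorem theorem1p4:
  shows "\<exists>g\<in>bloch_space.
    (\<forall>\<epsilon>>0. \<exists>C>0. \<forall>z\<in>unit_disc. \<forall>\<zeta>\<in>unit_disc.
        cmod (g z - g \<zeta>) \<le> C + \<epsilon> * hyperbolic_dist z \<zeta>) \<and>
    (\<forall>p::ereal. 0 < p \<and> p \<le> \<infinity> \<longrightarrow> g \<notin> bloch_closure (hardy_space p \<inter> bloch_space))"
  using factorial_series_in_bloch_space factorial_series_growth factorial_series_not_in_bloch_closure
  by blast

end
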